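(* Let $b\ge 2$ and $n\ge 0$ be integers. Then $R_b(n)$ contains every $b$-ary partition of $n$, and the ordered set $(R_b(n),\le)$ is a distributive lattice in which, for all $p,q\in R_b(n)$, the supremum $p\vee q$ and infimum $p\wedge q$ are the elements of $R_b(n)$ determined by $$s(p\vee q)_i=\min(s(p)_i,s(q)_i)\quad\text{and}\quad s(p\wedge q)_i=\max(s(p)_i,s(q)_i)\qquad\text{for all } i\ge 0.$$
   Context: For an integer $n\ge 0$, a $b$-ary partition of $n$ is a sequence $p=(p_0,p_1,p_2,\dots)$ of non-negative integers, only finitely many nonzero, with $\sum_{i\ge 0}p_ib^i=n$; it is written as a finite tuple $(p_0,\dots,p_{k-1})$, later components being $0$; $(n)$ denotes $(n,0,0,\dots)$. For $i\ge 0$ and a $b$-ary partition $p$ with $p_i\ge b$, "firing $i$" transforms $p$ into the $b$-ary partition $q$ with $q_i=p_i-b$, $q_{i+1}=p_{i+1}+1$ and $q_j=p_j$ for $j\notin\{i,i+1\}$. $R_b(n)$ is the set of $b$-ary partitions of $n$ obtainable from $(n)$ by a finite sequence of firings, ordered by: $p\le q$ iff $p$ is obtainable from $q$ by a finite (possibly empty) sequence of firings. For $p\in R_b(n)$, the number of firings of $i$ in a firing sequence from $(n)$ to $p$ does not depend on the chosen sequence; it is denoted $s(p)_i$ (the shot vector of $p$). *)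

theory Defs
  imports "HOL-Algebra.Lattice"
begin

definition bary_partition :: "nat \<Rightarrow> nat \<Rightarrow> (nat \<Rightarrow> nat) \<Rightarrow> bool" where
  "bary_partition b n p \<longleftrightarrow>
     finite {i. p i \<noteq> 0} \<and> (\<Sum>i | p i \<noteq> 0. p i * b ^ i) = n"

definition trivial_partition :: "nat \<Rightarrow> nat \<Rightarrow> nat" where
  "trivial_partition n = (\<lambda>_. 0)(0 := n)"

(* Only meaningful when p i \<ge> b; this side condition is imposed in firing_seq. *)
definition fire :: "nat \<Rightarrow> nat \<Rightarrow> (nat \<Rightarrow> nat) \<Rightarrow> (nat \<Rightarrow> nat)" where
  "fire b i p = p(i := p i - b, Suc i := p (Suc i) + 1)"

(* firing_seq b is p q: firing the positions listed in is, from left to right, is legal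
   at every step and transforms p into q. *)
primrec firing_seq :: "nat \<Rightarrow> nat list \<Rightarrow> (nat \<Rightarrow> nat) \<Rightarrow> (nat \<Rightarrow> nat) \<Rightarrow> bool" where
  "firing_seq b [] p q \<longleftrightarrow> q = p"
| "firing_seq b (i # is) p q \<longleftrightarrow> b \<le> p i \<and> firing_seq b is (fire b i p) q"

definition obtainable :: "nat \<Rightarrow> (nat \<Rightarrow> nat) \<Rightarrow> (nat \<Rightarrow> nat) \<Rightarrow> bool" where
  "obtainable b p q \<longleftrightarrow> (\<exists>is. firing_seq b is p q)"

definition R :: "nat \<Rightarrow> nat \<Rightarrow> (nat \<Rightarrow> nat) set" where
  "R b n = {p. bary_partition b n p \<and> obtainable b (trivial_partition n) p}"

(* The smaller element is the one obtained by firing, so (n) is the greatest element. *)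
definition R_order :: "nat \<Rightarrow> nat \<Rightarrow> (nat \<Rightarrow> nat) gorder" where
  "R_order b n = \<lparr>carrier = R b n, eq = (=), le = (\<lambda>p q. obtainable b q p)\<rparr>"

definition shot :: "nat \<Rightarrow> nat \<Rightarrow> (nat \<Rightarrow> nat) \<Rightarrow> nat \<Rightarrow> nat" where
  "shot b n p i =
     (THE k. \<exists>is. firing_seq b is (trivial_partition n) p \<and> count_list is i = k)"

locale distributive_lattice = lattice +
  assumes meet_join_distrib:
    "\<lbrakk>x \<in> carrier L; y \<in> carrier L; z \<in> carrier L\<rbrakk> \<Longrightarrow>
       x \<sqinter> (y \<squnion> z) = (x \<sqinter> y) \<squnion> (x \<sqinter> z)"

(* The remaining lemmas show that the description in shot_def is well defined. *)

lemma firing_seq_0: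
  "firing_seq b is p q \<Longrightarrow> q 0 + b * count_list is 0 = p 0"
proof (induction "is" arbitrary: p)
  case (Cons j js)
  then have "q 0 + b * count_list js 0 = fire b j p 0" and "b \<le> p j" by auto
  then show ?case by (auto simp: fire_def)
qed simp

lemma firing_seq_Suc:
  "firing_seq b is p q \<Longrightarrow>
     q (Suc i) + b * count_list is (Suc i) = p (Suc i) + count_list is i"
proof (induction "is" arbitrary: p)
  case (Cons j js)
  then have "q (Suc i) + b * count_list js (Suc i) = fire b j p (Suc i) + count_list js i"
    and "b \<le> p j" by auto
  then show ?case by (auto simp: fire_def)
qed simp

lemma count_list_firing_seq_unique:
  assumes "0 < b" and "firing_seq b is p q" and "firing_seq b js p q"
  shows "count_list is i = count_list js i"
proof (induction i)
  case 0
  show ?case using firing_seq_0[OF assms(2)] firing_seq_0[OF assms(3)] assms(1)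
    by (metis add_left_cancel mult_left_cancel not_gr_zero)
next
  case (Suc i)
  have "q (Suc i) + b * count_list is (Suc i) = q (Suc i) + b * count_list js (Suc i)"
    using firing_seq_Suc[OF assms(2)] firing_seq_Suc[OF assms(3)] Suc by metis
  then show ?case using assms(1) by simp
qed

lemma shot_eq_count_list:
  assumes "0 < b" and "firing_seq b is (trivial_partition n) p"
  shows "shot b n p i = count_list is i"
  unfolding shot_def using assms count_list_firing_seq_unique by blast

end

(* A partition of n is p i = s (i - 1) - b * s i, with s (-1) = n, for a unique s satisfying
   b * s i \<le> s (i - 1); this s is its shot vector.  These inequalities are preserved by pointwise
   minimum and maximum.  If s \<le> t are shot vectors and i is the least index with s i < t i, then
   b * (s i + 1) \<le> b * t i \<le> t (i - 1) = s (i - 1), so i can be fired at s; iterating leads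
   from s to t.  Hence the order is the reversed pointwise order on shot vectors. *)
theory Submission
  imports Defs
begin

section \<open>Shot vectors and the configurations they determine\<close>

definition shot_vector :: "nat \<Rightarrow> nat \<Rightarrow> (nat \<Rightarrow> nat) \<Rightarrow> bool" where
  "shot_vector b n s \<longleftrightarrow> (\<forall>i. b * s i \<le> case_nat n s i)"

text \<open>\<open>case_nat n s\<close> is s shifted by one place with n in front, as if the initial
  n came from n firings of a virtual position -1. The truncated subtraction is exact at every index
  precisely when \<open>shot_vector b n s\<close> holds.\<close>

definition config :: "nat \<Rightarrow> nat \<Rightarrow> (nat \<Rightarrow> nat) \<Rightarrow> (nat \<Rightarrow> nat)" where
  "config b n s i = case_nat n s i - b * s i"

lemma shot_vectorD:
  assumes "shot_vector b n s"
  shows "b * s 0 \<le> n" "b * s (Suc i) \<le> s i"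
proof -
  have "\<And>i. b * s i \<le> case_nat n s i" using assms by (simp add: shot_vector_def)
  from this[of 0] this[of "Suc i"] show "b * s 0 \<le> n" "b * s (Suc i) \<le> s i" by simp_all
qed

lemma config_zero: "config b n (\<lambda>_. 0) = trivial_partition n"
  by (auto simp: config_def trivial_partition_def fun_eq_iff split: nat.split)

lemma shot_vector_zero: "shot_vector b n (\<lambda>_. 0)"
  by (simp add: shot_vector_def)

text \<open>Multiplication by b is monotone, and the shift commutes with pointwise minimum because
  both sequences have the same n in front.\<close>

lemma shot_vector_min:
  assumes "shot_vector b n s" "shot_vector b n t"
  shows "shot_vector b n (\<lambda>i. min (s i) (t i))"
  unfolding shot_vector_def
proof
  fix i
  have "b * s i \<le> case_nat n s i" "b * t i \<le> case_nat n t i"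
    using assms by (auto simp: shot_vector_def)
  moreover have "b * min (s i) (t i) \<le> b * s i" "b * min (s i) (t i) \<le> b * t i"
    by simp_all
  ultimately have "b * min (s i) (t i) \<le> case_nat n s i" "b * min (s i) (t i) \<le> case_nat n t i"
    by linarith+
  then show "b * min (s i) (t i) \<le> case_nat n (\<lambda>i. min (s i) (t i)) i"
    by (cases i) auto
qed

lemma shot_vector_max:
  assumes "shot_vector b n s" "shot_vector b n t"
  shows "shot_vector b n (\<lambda>i. max (s i) (t i))"
  unfolding shot_vector_def
proof
  fix i
  have "b * s i \<le> case_nat n s i" "b * t i \<le> case_nat n t i"
    using assms by (auto simp: shot_vector_def)
  then show "b * max (s i) (t i) \<le> case_nat n (\<lambda>i. max (s i) (t i)) i"
    by (cases i) (auto simp: max_def)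
qed

text \<open>Without truncation, entry i of the configuration and the preceding entry of s determine
  \<open>b * s i\<close>, hence \<open>s i\<close>; the recursion starts from the common n.\<close>

lemma config_inj:
  assumes "b > 0" "shot_vector b n s" "shot_vector b n t" "config b n s = config b n t"
  shows "s = t"
proof
  fix i
  have eq: "case_nat n s i - b * s i = case_nat n t i - b * t i" for i
    using fun_cong[OF assms(4), of i] by (simp add: config_def)
  have le: "b * s i \<le> case_nat n s i" "b * t i \<le> case_nat n t i" for i
    using assms(2,3) by (simp_all add: shot_vector_def)
  have step: "s i = t i" if "case_nat n s i = case_nat n t i" for i
  proof -
    have "b * s i = b * t i" using eq[of i] le[of i] that by linarith
    then show ?thesis using \<open>b > 0\<close> by simp
  qed
  show "s i = t i"
    by (induction i) (auto intro!: step)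
qed

section \<open>Firing as incrementing a shot vector\<close>

lemma shot_vector_fire:
  assumes "shot_vector b n s" "b \<le> config b n s i"
  shows "shot_vector b n (s(i := Suc (s i)))"
  unfolding shot_vector_def
proof
  fix j
  have "b * s j \<le> case_nat n s j" using assms by (auto simp: shot_vector_def)
  \<comment> \<open>For positive b the truncated difference is positive, so the firing condition
    really provides room for one more b at position i. At \<open>Suc i\<close> the right-hand side
    only grows.\<close>
  moreover have "b * Suc (s i) \<le> case_nat n s i" if "b > 0"
    using assms(2) that by (simp add: config_def)
  ultimately show "b * (s(i := Suc (s i))) j \<le> case_nat n (s(i := Suc (s i))) j"
    by (cases "b = 0"; cases j) (auto simp: le_Suc_eq)
qed

text \<open>The hypothesis matters at position \<open>Suc i\<close>: the unit gained there may be
  moved out of the truncated difference only because that difference is exact.\<close>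

lemma config_fire:
  assumes "shot_vector b n s"
  shows "config b n (s(i := Suc (s i))) = fire b i (config b n s)"
proof
  fix j
  have "b * s j \<le> case_nat n s j" using assms by (auto simp: shot_vector_def)
  then show "config b n (s(i := Suc (s i))) j = fire b i (config b n s) j"
    by (cases j) (auto simp: config_def fire_def Suc_diff_le)
qed

text \<open>The start is an arbitrary s because the induction absorbs the first firing into it, and
  because comparing two elements of \<open>R b n\<close> needs sequences that do not start at
  (n).\<close>

lemma firing_seq_config:
  assumes "firing_seq b is (config b n s) q" "shot_vector b n s"
  shows "shot_vector b n (\<lambda>i. s i + count_list is i)
    \<and> q = config b n (\<lambda>i. s i + count_list is i)"
  using assms
proof (induction "is" arbitrary: s)
  case (Cons j js)
  let ?s = "s(j := Suc (s j))"
  have "(\<lambda>i. s i + count_list (j # js) i) = (\<lambda>i. ?s i + count_list js i)"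
    by (auto simp: fun_eq_iff)
  moreover have "firing_seq b js (config b n ?s) q" "shot_vector b n ?s"
    using Cons.prems by (auto simp: config_fire shot_vector_fire)
  ultimately show ?case using Cons.IH by metis
qed simp

lemma firing_seq_trivial_partition:
  assumes "firing_seq b is (trivial_partition n) q"
  shows "shot_vector b n (count_list is)" "q = config b n (count_list is)"
  using firing_seq_config[of b "is" n "\<lambda>_. 0" q] assms
  by (simp_all add: config_zero shot_vector_zero)

section \<open>Decay of shot vectors and reachability\<close>

lemma shot_vector_power_le:
  assumes "shot_vector b n s"
  shows "b ^ Suc i * s i \<le> n"
proof (induction i)
  case 0
  show ?case using shot_vectorD(1)[OF assms] by simp
next
  case (Suc i)
  have "b * s (Suc i) \<le> s i"
    using assms by (rule shot_vectorD)
  then have "b ^ Suc i * (b * s (Suc i)) \<le> b ^ Suc i * s i"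
    by (rule mult_le_mono2)
  also note Suc
  finally show ?case by (simp add: mult_ac)
qed

text \<open>A nonzero entry at i would force n to be at least \<open>b ^ Suc i\<close>, which
  exceeds i. This bounds all supports uniformly by n.\<close>

lemma shot_vector_eventually_zero:
  assumes "b \<ge> 2" "shot_vector b n s" "n \<le> i"
  shows "s i = 0"
proof (rule ccontr)
  assume "s i \<noteq> 0"
  have "i < 2 ^ i" by (rule less_exp)
  also have "\<dots> \<le> b ^ i" using assms(1) by (simp add: power_mono)
  also have "\<dots> \<le> b ^ Suc i * s i" using assms(1) \<open>s i \<noteq> 0\<close> by simp
  also have "\<dots> \<le> n" by (rule shot_vector_power_le[OF assms(2)])
  finally show False using assms(3) by simp
qed

text \<open>The induction measure is the total number of firings still missing. Summing over indices
  below n captures all of them, since t vanishes from n on.\<close>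

lemma obtainable_config:
  assumes "b \<ge> 2" "shot_vector b n s" "shot_vector b n t" "\<And>i. s i \<le> t i"
  shows "obtainable b (config b n s) (config b n t)"
  using assms(2,4)
proof (induction "\<Sum>i<n. t i - s i" arbitrary: s rule: less_induct)
  case less
  show ?case
  proof (cases "s = t")
    case True
    have "firing_seq b [] (config b n s) (config b n t)" using True by simp
    then show ?thesis unfolding obtainable_def by blast
  next
    case False
    then have ex: "\<exists>i. s i \<noteq> t i" by auto
    define i where "i = (LEAST i. s i \<noteq> t i)"
    have lt: "s i < t i"
      using LeastI_ex[OF ex] less.prems(2)[of i] by (simp add: i_def)
    have "s j = t j" if "j < i" for j
      using not_less_Least[of j] that by (auto simp: i_def)
    then have "case_nat n s i = case_nat n t i" by (cases i) auto
    moreover have "b * t i \<le> case_nat n t i" using assms(3) by (auto simp: shot_vector_def)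
    moreover have "b * Suc (s i) \<le> b * t i" using lt by (intro mult_le_mono2) simp
    ultimately have fireable: "b \<le> config b n s i" by (simp add: config_def)
    let ?s = "s(i := Suc (s i))"
    \<comment> \<open>A nonzero entry of t places i inside the range of summation, so firing i
      strictly lowers the measure.\<close>
    have "t i \<noteq> 0" using lt by simp
    then have "i < n"
      using shot_vector_eventually_zero[OF assms(1,3), of i] not_le by blast
    then have "(\<Sum>i<n. t i - ?s i) < (\<Sum>i<n. t i - s i)"
      using lt by (intro sum_strict_mono_ex1) auto
    moreover have "shot_vector b n ?s" using less.prems fireable by (simp add: shot_vector_fire)
    moreover have "?s j \<le> t j" for j using lt less.prems(2)[of j] by simp
    ultimately have "obtainable b (config b n ?s) (config b n t)"
      by (rule less.hyps)
    then obtain "is" where "firing_seq b is (fire b i (config b n s)) (config b n t)"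
      using less.prems by (auto simp: obtainable_def config_fire)
    then have "firing_seq b (i # is) (config b n s) (config b n t)" using fireable by simp
    then show ?thesis unfolding obtainable_def by blast
  qed
qed

section \<open>Partitions of n are exactly the configurations\<close>

lemma bary_partition_lessThan:
  assumes "\<And>i. i \<ge> N \<Longrightarrow> p i = 0"
  shows "bary_partition b n p \<longleftrightarrow> (\<Sum>i<N. p i * b ^ i) = n"
proof -
  have sub: "{i. p i \<noteq> 0} \<subseteq> {..<N}"
    using assms by (metis (mono_tags) lessThan_iff mem_Collect_eq not_le subsetI)
  then have "finite {i. p i \<noteq> 0}" by (rule finite_subset) simp
  moreover have "(\<Sum>i | p i \<noteq> 0. p i * b ^ i) = (\<Sum>i<N. p i * b ^ i)"
    using sub by (intro sum.mono_neutral_left) auto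
  ultimately show ?thesis by (simp add: bary_partition_def)
qed

text \<open>The sum telescopes: weighted by \<open>b ^ i\<close>, entry i is the difference of two
  consecutive terms \<open>b ^ i * case_nat n s i\<close>. The remainder is kept on the left to
  avoid truncated subtraction.\<close>

lemma sum_config:
  assumes "shot_vector b n s"
  shows "(\<Sum>i<Suc N. config b n s i * b ^ i) + b ^ Suc N * s N = n"
proof (induction N)
  case 0
  show ?case using shot_vectorD(1)[OF assms] by (simp add: config_def)
next
  case (Suc N)
  have "b * s (Suc N) \<le> s N"
    using assms by (rule shot_vectorD)
  then have "config b n s (Suc N) + b * s (Suc N) = s N" by (simp add: config_def)
  then have "b ^ Suc N * s N = config b n s (Suc N) * b ^ Suc N + b ^ Suc (Suc N) * s (Suc N)"
    by (metis add_mult_distrib2 mult.assoc mult.commute power_Suc2)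
  then show ?case using Suc by simp
qed

lemma bary_partition_config:
  assumes "b \<ge> 2" "shot_vector b n s"
  shows "bary_partition b n (config b n s)"
proof -
  have "s i = 0" if "i \<ge> n" for i
    using shot_vector_eventually_zero[OF assms that] .
  \<comment> \<open>Position n may still hold what firings of n - 1 put there, so the support bound
    is one larger than for s. The remainder of \<open>sum_config\<close> at n contains
    \<open>s n\<close> and vanishes.\<close>
  moreover from this have "config b n s i = 0" if "i \<ge> Suc n" for i
    using that by (cases i) (auto simp: config_def)
  ultimately show ?thesis
    using sum_config[OF assms(2), of n] by (subst bary_partition_lessThan[of "Suc n"]) auto
qed

text \<open>Only the partition equation is assumed, so combined with
  \<open>obtainable_config\<close> this shows that every partition is reachable.\<close>

lemma bary_partition_imp_config:
  assumes "bary_partition b n p"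
  obtains s where "shot_vector b n s" "p = config b n s"
proof -
  have "finite {i. p i \<noteq> 0}" using assms by (simp add: bary_partition_def)
  then obtain N where "\<forall>i\<in>{i. p i \<noteq> 0}. i < N"
    unfolding finite_nat_set_iff_bounded by blast
  then have N: "p i = 0" if "i \<ge> N" for i
    using that by (auto simp flip: not_less)
  \<comment> \<open>This solves \<open>s i = p (Suc i) + b * s (Suc i)\<close> from the far end:
    \<open>s i\<close> is the value of the tail of p beyond i in units of \<open>b ^ Suc i\<close>.
    A window of fixed length N suffices because p vanishes from N on.\<close>
  define s where "s = (\<lambda>i. \<Sum>j<N. p (Suc i + j) * b ^ j)"
  have shift: "(\<Sum>j<Suc N. p (i + j) * b ^ j) = p i + b * s i" for i
    by (subst sum.lessThan_Suc_shift) (simp add: s_def sum_distrib_left mult_ac)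
  have "(\<Sum>i<Suc N. p i * b ^ i) = n"
    using assms bary_partition_lessThan[of "Suc N" p] N by simp
  then have zero: "n = p 0 + b * s 0" using shift[of 0] by simp
  \<comment> \<open>The window of length \<open>Suc N\<close> in \<open>shift\<close> has one extra
    term, at \<open>Suc i + N\<close>, which lies outside the support of p.\<close>
  have suc: "s i = p (Suc i) + b * s (Suc i)" for i
    using shift[of "Suc i"] N[of "Suc i + N"] by (simp add: s_def)
  have eq: "case_nat n s i = p i + b * s i" for i
  proof (cases i)
    case 0
    then show ?thesis using zero by simp
  next
    case (Suc j)
    show ?thesis unfolding Suc nat.case by (rule suc)
  qed
  show thesis
  proof
    show "shot_vector b n s" by (simp add: shot_vector_def eq)
    show "p = config b n s" by (simp add: config_def fun_eq_iff eq)
  qed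
qed

section \<open>Elements of R correspond to shot vectors\<close>

lemma R_eq_config_image:
  assumes "b \<ge> 2"
  shows "R b n = config b n ` {s. shot_vector b n s}"
proof -
  \<comment> \<open>The zero vector lies below every shot vector and its configuration is (n), so
    every configuration is reachable from (n).\<close>
  have "config b n s \<in> R b n" if "shot_vector b n s" for s
    using obtainable_config[OF assms shot_vector_zero that] bary_partition_config[OF assms that]
    by (simp add: R_def config_zero)
  moreover have "p \<in> config b n ` {s. shot_vector b n s}" if "p \<in> R b n" for p
  proof -
    have "bary_partition b n p" using that by (simp add: R_def)
    then obtain s where "shot_vector b n s" "p = config b n s"
      by (rule bary_partition_imp_config)
    then show ?thesis by blast
  qed
  ultimately show ?thesis by auto
qed

lemma bary_partition_in_R:
  assumes "b \<ge> 2" "bary_partition b n p"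
  shows "p \<in> R b n"
  using bary_partition_imp_config[OF assms(2)] unfolding R_eq_config_image[OF assms(1)] by blast

text \<open>The counts of any firing sequence from (n) to this configuration form a shot vector with
  the same configuration, so injectivity applies. Thus \<open>shot\<close> inverts
  \<open>config\<close>.\<close>

lemma shot_config:
  assumes "b \<ge> 2" "shot_vector b n s"
  shows "shot b n (config b n s) = s"
proof -
  obtain "is" where "is": "firing_seq b is (trivial_partition n) (config b n s)"
    using obtainable_config[OF assms(1) shot_vector_zero assms(2)]
    by (auto simp: obtainable_def config_zero)
  have "count_list is = s"
    using firing_seq_trivial_partition[OF "is"] assms config_inj[of b n] by force
  then show ?thesis using shot_eq_count_list[OF _ "is"] assms(1) by auto
qed

lemma shot_vector_shot:
  assumes "b \<ge> 2" "p \<in> R b n"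
  shows "shot_vector b n (shot b n p)"
  using assms by (auto simp: R_eq_config_image shot_config)

lemma config_shot:
  assumes "b \<ge> 2" "p \<in> R b n"
  shows "config b n (shot b n p) = p"
  using assms by (auto simp: R_eq_config_image shot_config)

text \<open>Further firings only add to the counts; conversely, pointwise comparison is what
  \<open>obtainable_config\<close> turns into a firing sequence.\<close>

lemma obtainable_iff_shot_le:
  assumes "b \<ge> 2" "p \<in> R b n" "q \<in> R b n"
  shows "obtainable b p q \<longleftrightarrow> (\<forall>i. shot b n p i \<le> shot b n q i)"
proof
  assume "\<forall>i. shot b n p i \<le> shot b n q i"
  then show "obtainable b p q"
    using obtainable_config[OF assms(1) shot_vector_shot[OF assms(1,2)] shot_vector_shot[OF assms(1,3)]]
    by (simp add: config_shot assms)
next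
  assume "obtainable b p q"
  then obtain "is" where "firing_seq b is (config b n (shot b n p)) q"
    using assms by (auto simp: obtainable_def config_shot)
  from firing_seq_config[OF this shot_vector_shot[OF assms(1,2)]]
  have "shot b n q = (\<lambda>i. shot b n p i + count_list is i)"
    using shot_config[OF assms(1)] by blast
  then show "\<forall>i. shot b n p i \<le> shot b n q i" by simp
qed

lemma R_eqI:
  assumes "b \<ge> 2" "p \<in> R b n" "q \<in> R b n" "\<And>i. shot b n p i = shot b n q i"
  shows "p = q"
proof -
  have "shot b n p = shot b n q" using assms(4) by blast
  then show ?thesis using assms(1-3) by (metis config_shot)
qed

section \<open>The lattice structure\<close>

lemma carrier_R_order [simp]: "carrier (R_order b n) = R b n"
  by (simp add: R_order_def)

lemma eq_R_order [simp]: "(.=\<^bsub>R_order b n\<^esub>) = (=)"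
  by (simp add: R_order_def)

lemma le_R_order_iff:
  assumes "b \<ge> 2" "p \<in> R b n" "q \<in> R b n"
  shows "p \<sqsubseteq>\<^bsub>R_order b n\<^esub> q \<longleftrightarrow> (\<forall>i. shot b n q i \<le> shot b n p i)"
  using obtainable_iff_shot_le[OF assms(1,3,2)] by (simp add: R_order_def)

text \<open>Antisymmetry rests on injectivity: mutual obtainability gives equal shot vectors, hence
  equal elements.\<close>

lemma partial_order_R_order:
  assumes "b \<ge> 2"
  shows "partial_order (R_order b n)"
proof
  fix x y z
  assume *: "x \<in> carrier (R_order b n)" "y \<in> carrier (R_order b n)"
  then show "x .=\<^bsub>R_order b n\<^esub> y" if "x \<sqsubseteq>\<^bsub>R_order b n\<^esub> y" "y \<sqsubseteq>\<^bsub>R_order b n\<^esub> x"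
    using that assms by (auto simp: le_R_order_iff intro!: R_eqI[OF assms] le_antisym)
  assume "z \<in> carrier (R_order b n)" "x \<sqsubseteq>\<^bsub>R_order b n\<^esub> y" "y \<sqsubseteq>\<^bsub>R_order b n\<^esub> z"
  then show "x \<sqsubseteq>\<^bsub>R_order b n\<^esub> z"
    using * assms by (auto simp: le_R_order_iff intro: order_trans)
qed (use assms in \<open>auto simp: le_R_order_iff\<close>)

text \<open>The order reverses shot vectors, so their pointwise minimum, again a shot vector, yields
  the supremum.\<close>

lemma least_R_order_min:
  assumes "b \<ge> 2" "p \<in> R b n" "q \<in> R b n"
  shows "least (R_order b n) (config b n (\<lambda>i. min (shot b n p i) (shot b n q i)))
    (Upper (R_order b n) {p, q})"
proof -
  have sv: "shot_vector b n (\<lambda>i. min (shot b n p i) (shot b n q i))"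
    using assms by (intro shot_vector_min shot_vector_shot)
  then have "config b n (\<lambda>i. min (shot b n p i) (shot b n q i)) \<in> R b n"
    using assms(1) by (auto simp: R_eq_config_image)
  then show ?thesis
    using assms sv by (auto simp: least_def Upper_def le_R_order_iff shot_config)
qed

lemma greatest_R_order_max:
  assumes "b \<ge> 2" "p \<in> R b n" "q \<in> R b n"
  shows "greatest (R_order b n) (config b n (\<lambda>i. max (shot b n p i) (shot b n q i)))
    (Lower (R_order b n) {p, q})"
proof -
  have sv: "shot_vector b n (\<lambda>i. max (shot b n p i) (shot b n q i))"
    using assms by (intro shot_vector_max shot_vector_shot)
  then have "config b n (\<lambda>i. max (shot b n p i) (shot b n q i)) \<in> R b n"
    using assms(1) by (auto simp: R_eq_config_image)
  then show ?thesis
    using assms sv by (auto simp: greatest_def Lower_def le_R_order_iff shot_config)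
qed

lemma lattice_R_order:
  assumes "b \<ge> 2"
  shows "lattice (R_order b n)"
proof -
  interpret partial_order "R_order b n" by (rule partial_order_R_order[OF assms])
  show ?thesis
    by unfold_locales
      (use assms in \<open>auto intro: least_R_order_min greatest_R_order_max\<close>)
qed

text \<open>The library join is a choice of some least upper bound; uniqueness of least elements
  identifies it with the explicit one.\<close>

lemma join_R_order:
  assumes "b \<ge> 2" "p \<in> R b n" "q \<in> R b n"
  shows "p \<squnion>\<^bsub>R_order b n\<^esub> q = config b n (\<lambda>i. min (shot b n p i) (shot b n q i))"
proof -
  interpret lattice "R_order b n" by (rule lattice_R_order[OF assms(1)])
  show ?thesis
    using least_unique least_R_order_min[OF assms] sup_of_two_least assms
    by (metis carrier_R_order join_def)
qed

lemma meet_R_order: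
  assumes "b \<ge> 2" "p \<in> R b n" "q \<in> R b n"
  shows "p \<sqinter>\<^bsub>R_order b n\<^esub> q = config b n (\<lambda>i. max (shot b n p i) (shot b n q i))"
proof -
  interpret lattice "R_order b n" by (rule lattice_R_order[OF assms(1)])
  show ?thesis
    using greatest_unique greatest_R_order_max[OF assms] inf_of_two_greatest assms
    by (metis carrier_R_order meet_def)
qed

lemma shot_join:
  assumes "b \<ge> 2" "p \<in> R b n" "q \<in> R b n"
  shows "shot b n (p \<squnion>\<^bsub>R_order b n\<^esub> q) i = min (shot b n p i) (shot b n q i)"
  using assms by (simp add: join_R_order shot_config shot_vector_min shot_vector_shot)

lemma shot_meet:
  assumes "b \<ge> 2" "p \<in> R b n" "q \<in> R b n"
  shows "shot b n (p \<sqinter>\<^bsub>R_order b n\<^esub> q) i = max (shot b n p i) (shot b n q i)"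
  using assms by (simp add: meet_R_order shot_config shot_vector_max shot_vector_shot)

lemma join_in_R:
  assumes "b \<ge> 2" "p \<in> R b n" "q \<in> R b n"
  shows "p \<squnion>\<^bsub>R_order b n\<^esub> q \<in> R b n"
proof -
  interpret lattice "R_order b n" by (rule lattice_R_order[OF assms(1)])
  show ?thesis using join_closed assms by simp
qed

lemma meet_in_R:
  assumes "b \<ge> 2" "p \<in> R b n" "q \<in> R b n"
  shows "p \<sqinter>\<^bsub>R_order b n\<^esub> q \<in> R b n"
proof -
  interpret lattice "R_order b n" by (rule lattice_R_order[OF assms(1)])
  show ?thesis using meet_closed assms by simp
qed

text \<open>Elements are determined by their shot vectors, so the law reduces to max distributing
  over min in the natural numbers.\<close>

lemma distributive_lattice_R_order:
  assumes "b \<ge> 2"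
  shows "distributive_lattice (R_order b n)"
proof -
  interpret lattice "R_order b n" by (rule lattice_R_order[OF assms])
  show ?thesis
  proof
    fix x y z
    assume "x \<in> carrier (R_order b n)" "y \<in> carrier (R_order b n)" "z \<in> carrier (R_order b n)"
    then show "x \<sqinter>\<^bsub>R_order b n\<^esub> (y \<squnion>\<^bsub>R_order b n\<^esub> z)
        = (x \<sqinter>\<^bsub>R_order b n\<^esub> y) \<squnion>\<^bsub>R_order b n\<^esub> (x \<sqinter>\<^bsub>R_order b n\<^esub> z)"
      using assms
      by (intro R_eqI[OF assms, where n = n])
        (simp_all add: join_in_R meet_in_R shot_join shot_meet max_min_distrib2)
  qed
qed

theorem theorem1:
  fixes b n :: nat
  assumes "b \<ge> 2"
  shows "{p. bary_partition b n p} \<subseteq> R b n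
    \<and> distributive_lattice (R_order b n)
    \<and> (\<forall>p \<in> R b n. \<forall>q \<in> R b n.
          p \<squnion>\<^bsub>R_order b n\<^esub> q \<in> R b n
        \<and> p \<sqinter>\<^bsub>R_order b n\<^esub> q \<in> R b n
        \<and> (\<forall>r \<in> R b n. r = p \<squnion>\<^bsub>R_order b n\<^esub> q \<longleftrightarrow>
              (\<forall>i. shot b n r i = min (shot b n p i) (shot b n q i)))
        \<and> (\<forall>r \<in> R b n. r = p \<sqinter>\<^bsub>R_order b n\<^esub> q \<longleftrightarrow>
              (\<forall>i. shot b n r i = max (shot b n p i) (shot b n q i))))"
proof (intro conjI ballI)
  show "{p. bary_partition b n p} \<subseteq> R b n"
    using bary_partition_in_R[OF assms] by blast
  show "distributive_lattice (R_order b n)"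
    by (rule distributive_lattice_R_order[OF assms])
  fix p q
  assume pq: "p \<in> R b n" "q \<in> R b n"
  show join: "p \<squnion>\<^bsub>R_order b n\<^esub> q \<in> R b n" and meet: "p \<sqinter>\<^bsub>R_order b n\<^esub> q \<in> R b n"
    using pq assms by (auto intro: join_in_R meet_in_R)
  fix r
  assume r: "r \<in> R b n"
  \<comment> \<open>The formula for the join gives one direction; the other is that the shot vector
    determines the element of \<open>R b n\<close>.\<close>
  show "r = p \<squnion>\<^bsub>R_order b n\<^esub> q \<longleftrightarrow> (\<forall>i. shot b n r i = min (shot b n p i) (shot b n q i))"
    using R_eqI[OF assms r join] shot_join[OF assms pq] by auto
  show "r = p \<sqinter>\<^bsub>R_order b n\<^esub> q \<longleftrightarrow> (\<forall>i. shot b n r i = max (shot b n p i) (shot b n q i))"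
    using R_eqI[OF assms r meet] shot_meet[OF assms pq] by auto
qed

end
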